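(* Let $F:\mathbb{R}^n\to\mathbb{R}^n$ be continuously differentiable with Jacobian $J$, and let $F(x^* )=0$. Suppose that $J$ is Lipschitz continuous in a neighbourhood of $x^*$, i.e. there is $L>0$ such that $\|J(x)-J(y)\|\le L\|x-y\|$ for all $x,y$ in a neighbourhood of $x^*$, and that there are $\delta>0$ and $m>0$ such that $\|J(x)y\|\ge m\|y\|$ for all $y\in\mathbb{R}^n$ and all $x\in B_\delta(x^* )$. If the regularization parameter $\mu_k$ and the constant $c_\epsilon$ of the CNMTr algorithm (described in the context) satisfy $\mu_k\le c_\epsilon<0.5\,m$, then there exists a neighbourhood $B_r(x^* )$, $r>0$, such that every sequence $\{x_k\}$ generated by the CNMTr algorithm with $x_0\in B_r(x^* )$ converges superlinearly to $x^*$.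
   Context: $\|\cdot\|$ is the Euclidean norm on vectors and its induced norm on matrices; $J(x)=\partial F(x)/\partial x$; $I$ is the identity matrix; $B_\delta(x^* )=\{x:\|x-x^*\|\le\delta\}$. The sequence $\{x_k\}$ converges superlinearly to $x^*$ if $x_k\to x^*$ and $\lim_{k\to\infty}\|x_{k+1}-x^*\|/\|x_k-x^*\|=0$. CNMTr algorithm. Constants: $\eta_a=10^{-6}$, $\eta_1=0.25$, $\eta_2=0.75$, $\gamma_1=2$, $\gamma_2=0.5$, and a small positive constant $c_\epsilon$. Given a starting point $x_0\in\mathbb{R}^n$ and $\Delta t_0=10^{-2}$, for $k=0,1,2,\ldots$: 1. If $k=0$ or the previous trial step was accepted, let $s_k^P$ be the solution of $(\mu_k I-J(x_k))s_k^P=F(x_k)$, where $\mu_k=c_\epsilon$ if $\Delta t_k\le 1/c_\epsilon$ and $\mu_k=1/\Delta t_k$ otherwise. If the previous trial step was rejected, $s_k^P=s_{k-1}^P$ is reused. 2. Set $s_k=\frac{\Delta t_k}{1+\Delta t_k}s_k^P$; the trial point is $x_k+s_k$. 3. If $\|F(x_k)\|<\|F(x_k)+J(x_k)s_k\|$ set $\rho_k=-1$; otherwise set $\rho_k=\dfrac{\|F(x_k)\|-\|F(x_k+s_k)\|}{\|F(x_k)\|-\|F(x_k)+J(x_k)s_k\|}$. 4. Set $\Delta t_{k+1}=\gamma_1\Delta t_k$ if $|1-\rho_k|\le\eta_1$; $\Delta t_{k+1}=\Delta t_k$ if $\eta_1<|1-\rho_k|<\eta_2$; $\Delta t_{k+1}=\gamma_2\Delta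 t_k$ otherwise. 5. If $\rho_k\ge\eta_a$, accept: $x_{k+1}=x_k+s_k$. Otherwise reject: $x_{k+1}=x_k$. The iteration stops only if $F(x_k)=0$; asymptotic statements concern the case in which an infinite sequence is generated. *)

theory Defs
  imports "HOL-Analysis.Analysis"
begin

definition eta_accept :: real where "eta_accept = 1 / 10 ^ 6"
definition eta1 :: real where "eta1 = 0.25"
definition eta2 :: real where "eta2 = 0.75"
definition gamma1 :: real where "gamma1 = 2"
definition gamma2 :: real where "gamma2 = 0.5"

text \<open>The norm of the type \<open>real^'n^'n\<close> is the Frobenius norm; the matrix norm
  induced by the Euclidean vector norm is the operator norm below.\<close>

definition induced_norm :: "real^'n^'m \<Rightarrow> real" where
  "induced_norm A = onorm (\<lambda>v. A *v v)"

definition reg_param :: "real \<Rightarrow> real \<Rightarrow> real" where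
  "reg_param c dt = (if dt \<le> 1 / c then c else 1 / dt)"

text \<open>If the predicted reduction in the denominator is zero, the quotient is zero by the
  convention \<open>a / 0 = 0\<close>, so that such a trial step is rejected.\<close>

definition trust_ratio ::
  "(real^'n \<Rightarrow> real^'n) \<Rightarrow> (real^'n \<Rightarrow> real^'n^'n) \<Rightarrow> real^'n \<Rightarrow> real^'n \<Rightarrow> real" where
  "trust_ratio F J x s =
     (if norm (F x) < norm (F x + J x *v s) then -1
      else (norm (F x) - norm (F (x + s))) / (norm (F x) - norm (F x + J x *v s)))"

definition next_time_step :: "real \<Rightarrow> real \<Rightarrow> real" where
  "next_time_step rho dt =
     (if \<bar>1 - rho\<bar> \<le> eta1 then gamma1 * dt
      else if \<bar>1 - rho\<bar> < eta2 then dt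
      else gamma2 * dt)"

text \<open>A non-terminating execution: \<open>x\<close>, \<open>dt\<close>, \<open>mu\<close>, \<open>sP\<close>, \<open>s\<close> and \<open>rho\<close> are the sequences of
  iterates, time steps, regularization parameters, solutions of the linear systems, trial
  steps and trust-region ratios. The iteration stops exactly at zeros of \<open>F\<close>, so none of the
  iterates of an infinite sequence is a zero. Trial step \<open>k - 1\<close> was accepted iff
  \<open>rho (k - 1) \<ge> eta_accept\<close>. At a singular matrix, any solution of the linear system
  (if there is one) may be taken.\<close>

definition cnmtr_run ::
  "(real^'n \<Rightarrow> real^'n) \<Rightarrow> (real^'n \<Rightarrow> real^'n^'n) \<Rightarrow> real \<Rightarrow> (nat \<Rightarrow> real^'n) \<Rightarrow> (nat \<Rightarrow> real) \<Rightarrow>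
   (nat \<Rightarrow> real) \<Rightarrow> (nat \<Rightarrow> real^'n) \<Rightarrow> (nat \<Rightarrow> real^'n) \<Rightarrow> (nat \<Rightarrow> real) \<Rightarrow> bool" where
  "cnmtr_run F J c x dt mu sP s rho \<longleftrightarrow>
     dt 0 = 1 / 10 ^ 2 \<and>
     (\<forall>k. F (x k) \<noteq> 0 \<and>
          mu k = reg_param c (dt k) \<and>
          (if k = 0 \<or> rho (k - 1) \<ge> eta_accept
           then (mu k *\<^sub>R mat 1 - J (x k)) *v sP k = F (x k)
           else sP k = sP (k - 1)) \<and>
          s k = (dt k / (1 + dt k)) *\<^sub>R sP k \<and>
          rho k = trust_ratio F J (x k) (s k) \<and>
          dt (Suc k) = next_time_step (rho k) (dt k) \<and>
          x (Suc k) = (if rho k \<ge> eta_accept then x k + s k else x k))"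

definition superlinearly_converges :: "(nat \<Rightarrow> 'a::real_normed_vector) \<Rightarrow> 'a \<Rightarrow> bool" where
  "superlinearly_converges x l \<longleftrightarrow>
     x \<longlonglongrightarrow> l \<and> (\<lambda>k. norm (x (Suc k) - l) / norm (x k - l)) \<longlonglongrightarrow> 0"

end

theory Submission imports Defs begin

text \<open>
  Write \<open>\<tau> = dt / (1 + dt)\<close> for the damping factor of a trial step \<open>s = \<tau> p\<close>. Since
  \<open>J p = \<mu> p - F\<close>, the linear model is \<open>F + J s = (1 - \<tau>) F + \<tau> \<mu> p\<close>. From
  \<open>\<mu> \<le> c < m / 2\<close> one gets \<open>\<parallel>p\<parallel> \<le> \<parallel>F\<parallel> / (m - c)\<close>, hence \<open>\<mu> \<parallel>p\<parallel> \<le> q \<parallel>F\<parallel>\<close> with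
  \<open>q = c / (m - c) < 1\<close>: the predicted reduction is at least \<open>\<tau> (1 - q) \<parallel>F\<parallel>\<close>, of first
  order in \<open>\<parallel>F\<parallel>\<close>, while the Lipschitz condition makes the error of the model of second order,
  \<open>O(\<tau>\<^sup>2 \<parallel>F\<parallel>\<^sup>2)\<close>. So where the residual is below some \<open>\<epsilon>\<close>, the trust ratio differs from
  \<open>1\<close> by at most \<open>1/4\<close> and the residual falls by the factor \<open>1 - 3/4 \<tau> (1 - q)\<close> (lemmas
  \<open>trust_ratio_near_one\<close> and \<open>residual_decrease\<close>).

  Near the zero, \<open>\<parallel>F x\<parallel>\<close> and \<open>\<parallel>x - xs\<parallel>\<close> are comparable (lemma \<open>residual_bounds_distance\<close>),
  so a decreasing residual keeps the iterates in the good region. Therefore a run that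
  starts close enough accepts every step and doubles the time step every time (lemma
  \<open>near_zero_run_invariant\<close>). Consequently \<open>\<tau> \<rightarrow> 1\<close> and, as \<open>\<mu> = 1 / dt\<close> eventually, \<open>\<mu> \<rightarrow> 0\<close>; the step tends
  to the Newton step, and the bound
  \<open>\<parallel>F (x + s)\<parallel> \<le> ((1 - \<tau>) + \<mu> / (m - c) + L \<parallel>F\<parallel> / (m - c)\<^sup>2) \<parallel>F\<parallel>\<close> (lemma
  \<open>residual_factor\<close>) has a factor that tends to zero. Comparability carries this over to the
  distances.
\<close>

section \<open>One damped regularized Newton step\<close>

text \<open>
  Here \<open>f\<close> and \<open>A\<close> stand for \<open>F x\<close> and \<open>J x\<close>, and \<open>g\<close> for \<open>F (x + s)\<close>. The smallness
  condition on \<open>f\<close> is chosen to make the model error at most a quarter of the predicted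
  reduction: that error is bounded by \<open>L (\<tau> \<parallel>f\<parallel> / (m - c))\<^sup>2\<close>, the reduction is at least
  \<open>\<tau> \<parallel>f\<parallel> (m - 2 c) / (m - c)\<close>, and \<open>\<tau> \<le> 1\<close>.
\<close>

locale regularized_step =
  fixes A :: "real^'n^'n" and f g p s :: "real^'n" and \<mu> \<tau> m c L :: real
  assumes system: "(\<mu> *\<^sub>R mat 1 - A) *v p = f"
    and lower: "m * norm p \<le> norm (A *v p)"
    and mu: "0 \<le> \<mu>" "\<mu> \<le> c" and c: "2 * c < m"
    and tau: "0 < \<tau>" "\<tau> \<le> 1"
    and step: "s = \<tau> *\<^sub>R p"
    and f_nonzero: "f \<noteq> 0"
    and L: "0 \<le> L"
    and model_error: "norm (g - f - A *v s) \<le> L * (norm s)\<^sup>2"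
    and f_small: "4 * L * norm f \<le> (m - c) * (m - 2 * c)"
begin

text \<open>
  This is \<open>1 - q\<close> with \<open>q = c / (m - c)\<close>: the part of the residual that the linear model of
  an undamped step is guaranteed to remove.
\<close>

definition reduction :: real where "reduction = (m - 2 * c) / (m - c)"

lemma gap_pos: "0 < m - c"
  using mu c by linarith

lemma reduction_pos: "0 < reduction"
  using gap_pos c by (simp add: reduction_def)

lemma applied_matrix: "A *v p = \<mu> *\<^sub>R p - f"
  using system by (simp add: matrix_vector_mult_diff_rdistrib scaleR_matrix_vector_assoc[symmetric]
      algebra_simps)

lemma solution_norm: "norm p \<le> norm f / (m - c)"
proof -
  have "m * norm p \<le> \<mu> * norm p + norm f"
    using lower norm_triangle_ineq4[of "\<mu> *\<^sub>R p" f] mu by (simp add: applied_matrix)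
  also have "\<dots> \<le> c * norm p + norm f"
    using mu by (simp add: mult_right_mono)
  finally show ?thesis
    using gap_pos by (simp add: field_simps)
qed

lemma step_norm: "norm s \<le> \<tau> * (norm f / (m - c))"
  using mult_left_mono[OF solution_norm, of \<tau>] tau by (simp add: step)

text \<open>
  Keeping \<open>\<mu>\<close> in the bound, instead of replacing it by \<open>c\<close>, is what later yields
  superlinear convergence from \<open>\<mu> \<rightarrow> 0\<close>.
\<close>

lemma model_norm: "norm (f + A *v s) \<le> ((1 - \<tau>) + \<tau> * (\<mu> / (m - c))) * norm f"
proof -
  have "f + A *v s = (1 - \<tau>) *\<^sub>R f + (\<tau> * \<mu>) *\<^sub>R p"
    by (simp add: step matrix_vector_mult_scaleR applied_matrix algebra_simps)
  then have "norm (f + A *v s) \<le> (1 - \<tau>) * norm f + (\<tau> * \<mu>) * norm p"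
    using norm_triangle_ineq[of "(1 - \<tau>) *\<^sub>R f" "(\<tau> * \<mu>) *\<^sub>R p"] tau mu by simp
  also have "\<dots> \<le> (1 - \<tau>) * norm f + (\<tau> * \<mu>) * (norm f / (m - c))"
    using mult_left_mono[OF solution_norm, of "\<tau> * \<mu>"] tau mu by simp
  finally show ?thesis
    by (simp add: algebra_simps)
qed

lemma model_decrease: "norm (f + A *v s) \<le> (1 - \<tau> * reduction) * norm f"
proof -
  have "1 - reduction = c / (m - c)"
    using gap_pos by (simp add: reduction_def field_simps)
  then have "\<mu> / (m - c) \<le> 1 - reduction"
    using mu gap_pos by (simp add: divide_right_mono)
  then have "(1 - \<tau>) + \<tau> * (\<mu> / (m - c)) \<le> 1 - \<tau> * reduction"
    using tau mult_left_mono[of "\<mu> / (m - c)" "1 - reduction" \<tau>] by (simp add: algebra_simps)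
  then show ?thesis
    using model_norm by (meson mult_right_mono norm_ge_zero order_trans)
qed

lemma error_quadratic:
  "norm (g - f - A *v s) \<le> \<tau>\<^sup>2 * (L * norm f / (m - c)\<^sup>2) * norm f"
proof -
  have "(norm s)\<^sup>2 \<le> (\<tau> * (norm f / (m - c)))\<^sup>2"
    using step_norm by (simp add: power_mono)
  then have "norm (g - f - A *v s) \<le> L * (\<tau> * (norm f / (m - c)))\<^sup>2"
    using model_error L by (meson mult_left_mono order_trans)
  then show ?thesis
    by (simp add: power2_eq_square mult_ac)
qed

lemma tau_square: "\<tau>\<^sup>2 \<le> \<tau>"
  using tau by (simp add: power2_eq_square mult_left_le)

lemma error_small: "norm (g - f - A *v s) \<le> \<tau> * reduction * norm f / 4"
proof -
  have "L * norm f / (m - c)\<^sup>2 \<le> ((m - c) * (m - 2 * c) / 4) / (m - c)\<^sup>2"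
    using f_small by (intro divide_right_mono) auto
  also have "\<dots> = reduction / 4"
    using gap_pos by (simp add: reduction_def power2_eq_square)
  finally have "L * norm f / (m - c)\<^sup>2 \<le> reduction / 4" .
  then have "\<tau>\<^sup>2 * (L * norm f / (m - c)\<^sup>2) \<le> \<tau> * (reduction / 4)"
    using tau_square L tau by (intro mult_mono) auto
  then have "\<tau>\<^sup>2 * (L * norm f / (m - c)\<^sup>2) * norm f \<le> \<tau> * (reduction / 4) * norm f"
    by (rule mult_right_mono) simp
  with error_quadratic show ?thesis
    by linarith
qed

lemma norm_error: "\<bar>norm g - norm (f + A *v s)\<bar> \<le> norm (g - f - A *v s)"
  using norm_triangle_ineq3[of g "f + A *v s"] by (simp add: diff_diff_eq)

lemma ratio_near_one:
  "norm (f + A *v s) \<le> norm f"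
  "\<bar>1 - (norm f - norm g) / (norm f - norm (f + A *v s))\<bar> \<le> 1 / 4"
proof -
  define pred where "pred = norm f - norm (f + A *v s)"
  have pred: "\<tau> * reduction * norm f \<le> pred"
    using model_decrease by (simp add: pred_def algebra_simps)
  moreover have "0 < \<tau> * reduction * norm f"
    using tau reduction_pos f_nonzero by simp
  ultimately have pos: "0 < pred"
    by linarith
  have "\<bar>1 - (norm f - norm g) / pred\<bar> = \<bar>norm g - norm (f + A *v s)\<bar> / pred"
    using pos by (simp add: pred_def divide_simps)
  also have "\<dots> \<le> 1 / 4"
    using norm_error error_small pred pos by (simp add: divide_simps)
  finally show "\<bar>1 - (norm f - norm g) / (norm f - norm (f + A *v s))\<bar> \<le> 1 / 4"
    by (simp add: pred_def)
  show "norm (f + A *v s) \<le> norm f"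
    using pos by (simp add: pred_def)
qed

lemma residual_decrease: "norm g \<le> (1 - 3 / 4 * (\<tau> * reduction)) * norm f"
  using norm_error error_small model_decrease by (simp add: algebra_simps)

lemma residual_factor:
  "norm g \<le> ((1 - \<tau>) + \<mu> / (m - c) + L * norm f / (m - c)\<^sup>2) * norm f"
proof -
  have "norm g \<le> ((1 - \<tau>) + \<tau> * (\<mu> / (m - c))) * norm f
      + \<tau>\<^sup>2 * (L * norm f / (m - c)\<^sup>2) * norm f"
    using norm_error error_quadratic model_norm by linarith
  also have "\<dots> = ((1 - \<tau>) + \<tau> * (\<mu> / (m - c)) + \<tau>\<^sup>2 * (L * norm f / (m - c)\<^sup>2)) * norm f"
    by (simp add: algebra_simps)
  also have "\<dots> \<le> ((1 - \<tau>) + 1 * (\<mu> / (m - c)) + 1 * (L * norm f / (m - c)\<^sup>2)) * norm f"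
    using tau tau_square mu L gap_pos
    by (intro mult_right_mono add_mono order_refl) auto
  finally show ?thesis
    by simp
qed

end

text \<open>
  The model value is below the residual, so the trust ratio takes its quotient form rather
  than the value \<open>-1\<close>; the quotient misses \<open>1\<close> by the model error relative to the predicted
  reduction.
\<close>

lemma trust_ratio_near_one:
  assumes "regularized_step (J x) (F x) (F (x + s)) p s \<mu> \<tau> m c L"
  shows "\<bar>1 - trust_ratio F J x s\<bar> \<le> 1 / 4"
  using regularized_step.ratio_near_one[OF assms] by (simp add: trust_ratio_def)

section \<open>Local geometry near a regular zero\<close>

text \<open>
  On the segment from \<open>x\<close> to \<open>y\<close> the Jacobian stays within \<open>L \<parallel>y - x\<parallel>\<close> of \<open>J x\<close>; the mean
  value inequality for \<open>F - J x\<close> turns this into a quadratic error.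
\<close>

lemma linearization_error:
  fixes F :: "real^'n \<Rightarrow> real^'n" and J :: "real^'n \<Rightarrow> real^'n^'n"
  assumes deriv: "\<And>x. (F has_derivative (\<lambda>h. J x *v h)) (at x)"
    and lip: "\<And>x y. x \<in> S \<Longrightarrow> y \<in> S \<Longrightarrow> induced_norm (J x - J y) \<le> L * norm (x - y)"
    and "convex S" and x: "x \<in> S" and y: "y \<in> S" and "0 \<le> L"
  shows "norm (F y - F x - J x *v (y - x)) \<le> L * (norm (y - x))\<^sup>2"
proof -
  let ?T = "closed_segment x y"
  have sub: "?T \<subseteq> S"
    using assms by (simp add: closed_segment_subset)
  have "norm (F y - F x - J x *v (y - x)) \<le> norm (y - x) * (L * norm (y - x))"
  proof (rule differentiable_bound_linearization[where S = ?T and f' = "\<lambda>z h. J z *v h"])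
    show "x + t *\<^sub>R (y - x) \<in> ?T" if "t \<in> {0..1}" for t
      using that by (auto simp: in_segment algebra_simps intro!: exI[of _ t])
    show "(F has_derivative (\<lambda>h. J z *v h)) (at z within ?T)" for z
      using deriv has_derivative_at_withinI by blast
    show "onorm ((\<lambda>h. J z *v h) - (\<lambda>h. J x *v h)) \<le> L * norm (y - x)" if z: "z \<in> ?T" for z
    proof -
      have "onorm ((\<lambda>h. J z *v h) - (\<lambda>h. J x *v h)) \<le> L * norm (z - x)"
        using lip[of z x] z sub x
        by (auto simp: induced_norm_def fun_diff_def matrix_vector_mult_diff_rdistrib)
      also have "\<dots> \<le> L * norm (y - x)"
        using segment_bound1[OF z] \<open>0 \<le> L\<close> by (simp add: mult_left_mono)
      finally show ?thesis .
    qed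
    show "x \<in> ?T" by simp
  qed
  then show ?thesis
    by (simp add: power2_eq_square mult_ac)
qed

text \<open>
  With \<open>z\<close> a zero of \<open>F\<close> and \<open>B\<close> its Jacobian there, \<open>F x\<close> is \<open>B (x - z)\<close> up to a quadratic
  error, which close to \<open>z\<close> uses up at most half of the lower bound \<open>m\<close>.
\<close>

lemma residual_bounds_distance:
  fixes F :: "real^'n \<Rightarrow> real^'n" and B :: "real^'n^'n"
  assumes err: "norm (F x - B *v (x - z)) \<le> L * (norm (x - z))\<^sup>2"
    and near: "L * norm (x - z) \<le> m / 2"
    and lower: "m * norm (x - z) \<le> norm (B *v (x - z))"
  shows "m / 2 * norm (x - z) \<le> norm (F x)"
    and "norm (F x) \<le> (induced_norm B + m / 2) * norm (x - z)"
proof -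
  have "norm (F x - B *v (x - z)) \<le> m / 2 * norm (x - z)"
    using err mult_right_mono[OF near norm_ge_zero[of "x - z"]] by (simp add: power2_eq_square mult_ac)
  moreover have "norm (B *v (x - z)) \<le> induced_norm B * norm (x - z)"
    unfolding induced_norm_def by (rule onorm) simp
  moreover have "norm (B *v (x - z)) \<le> norm (F x) + norm (F x - B *v (x - z))"
    by (metis norm_triangle_sub norm_minus_commute)
  moreover have "norm (F x) \<le> norm (B *v (x - z)) + norm (F x - B *v (x - z))"
    by (rule norm_triangle_sub)
  ultimately show "m / 2 * norm (x - z) \<le> norm (F x)"
    and "norm (F x) \<le> (induced_norm B + m / 2) * norm (x - z)"
    using lower by (simp_all add: algebra_simps)
qed

section \<open>Runs that start near the zero\<close>

lemma cnmtr_runD: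
  assumes "cnmtr_run F J c x dt mu sP s rho"
  shows "dt 0 = 1 / 100" "F (x k) \<noteq> 0" "mu k = reg_param c (dt k)"
    "k = 0 \<or> rho (k - 1) \<ge> eta_accept \<Longrightarrow> (mu k *\<^sub>R mat 1 - J (x k)) *v sP k = F (x k)"
    "s k = (dt k / (1 + dt k)) *\<^sub>R sP k" "rho k = trust_ratio F J (x k) (s k)"
    "dt (Suc k) = next_time_step (rho k) (dt k)"
    "x (Suc k) = (if rho k \<ge> eta_accept then x k + s k else x k)"
proof -
  from assms show "dt 0 = 1 / 100"
    by (simp add: cnmtr_run_def)
  note at_k = conjunct2[OF assms[unfolded cnmtr_run_def], THEN spec, of k]
  show "F (x k) \<noteq> 0" "mu k = reg_param c (dt k)"
    "s k = (dt k / (1 + dt k)) *\<^sub>R sP k" "rho k = trust_ratio F J (x k) (s k)"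
    "dt (Suc k) = next_time_step (rho k) (dt k)"
    "x (Suc k) = (if rho k \<ge> eta_accept then x k + s k else x k)"
    using at_k by blast+
  show "(mu k *\<^sub>R mat 1 - J (x k)) *v sP k = F (x k)" if "k = 0 \<or> rho (k - 1) \<ge> eta_accept"
    using conjunct1[OF conjunct2[OF conjunct2[OF at_k]]] by (simp only: that if_True)
qed

text \<open>
  Confinement rests on the residual rather than on the distance: a step may lead away from
  \<open>z\<close>, but its length is at most \<open>\<epsilon> / (m - c) \<le> 2 \<epsilon> / m\<close>, so the trial point is still in the
  ball of radius \<open>R\<close> where the estimates hold, and there the smaller residual pulls the
  distance bound back to \<open>2 \<epsilon> / m\<close>.
\<close>

lemma near_zero_run_invariant:
  fixes F :: "real^'n \<Rightarrow> real^'n" and J :: "real^'n \<Rightarrow> real^'n^'n"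
  assumes run: "cnmtr_run F J c x dt mu sP s rho"
    and mu_le: "\<And>k. mu k \<le> c" and c: "0 < c" "2 * c < m"
    and L: "0 \<le> L"
    and lower: "\<And>y v. norm (y - z) \<le> R \<Longrightarrow> m * norm v \<le> norm (J y *v v)"
    and lin: "\<And>y w. norm (y - z) \<le> R \<Longrightarrow> norm (w - z) \<le> R \<Longrightarrow>
        norm (F w - F y - J y *v (w - y)) \<le> L * (norm (w - y))\<^sup>2"
    and dist: "\<And>y. norm (y - z) \<le> R \<Longrightarrow> m / 2 * norm (y - z) \<le> norm (F y)"
    and eps: "4 * \<epsilon> \<le> m * R" "4 * L * \<epsilon> \<le> (m - c) * (m - 2 * c)"
    and start: "norm (x 0 - z) \<le> R" "norm (F (x 0)) \<le> \<epsilon>"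
  shows "dt k = 2 ^ k / 100 \<and> norm (x k - z) \<le> R \<and> norm (F (x k)) \<le> \<epsilon> \<and>
    regularized_step (J (x k)) (F (x k)) (F (x (Suc k))) (sP k) (s k) (mu k)
      (dt k / (1 + dt k)) m c L"
proof -
  have step_preserves: "dt (Suc k) = 2 * dt k \<and> rho k \<ge> eta_accept \<and> norm (x (Suc k) - z) \<le> R
      \<and> norm (F (x (Suc k))) \<le> \<epsilon>
      \<and> regularized_step (J (x k)) (F (x k)) (F (x (Suc k))) (sP k) (s k) (mu k)
        (dt k / (1 + dt k)) m c L"
    if inv: "0 < dt k" "norm (x k - z) \<le> R" "norm (F (x k)) \<le> \<epsilon>"
      "k = 0 \<or> rho (k - 1) \<ge> eta_accept" for k
  proof -
    let ?\<tau> = "dt k / (1 + dt k)"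
    have tau: "0 < ?\<tau>" "?\<tau> \<le> 1"
      using inv(1) by (simp_all add: field_simps)
    have mu: "0 \<le> mu k"
      using inv(1) c by (simp add: cnmtr_runD(3)[OF run, of k] reg_param_def)
    have system: "(mu k *\<^sub>R mat 1 - J (x k)) *v sP k = F (x k)"
      using cnmtr_runD(4)[OF run] inv(4) .
    have small: "4 * L * norm (F (x k)) \<le> (m - c) * (m - 2 * c)"
      using mult_left_mono[OF inv(3), of "4 * L"] L eps(2) by simp
    have step: "regularized_step (J (x k)) (F (x k)) g (sP k) (s k) (mu k) ?\<tau> m c L"
      if "norm (g - F (x k) - J (x k) *v s k) \<le> L * (norm (s k))\<^sup>2" for g
      using that system lower[OF inv(2), of "sP k"] mu mu_le[of k] c tau L small
        cnmtr_runD(5)[OF run, of k] cnmtr_runD(2)[OF run, of k]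
      by unfold_locales auto
    have half: "m * norm (x k - z) \<le> 2 * \<epsilon>"
      using dist[OF inv(2)] inv(3) by simp
    \<comment> \<open>The length bound does not depend on the trial value, so any value with a small model
      error serves; the model value itself has none.\<close>
    have "norm (s k) \<le> ?\<tau> * (norm (F (x k)) / (m - c))"
      by (rule regularized_step.step_norm[OF step[of "F (x k) + J (x k) *v s k"]])
        (simp add: L)
    also have "\<dots> \<le> 1 * (\<epsilon> / (m - c))"
      using tau inv(3) c by (intro mult_mono divide_right_mono) auto
    finally have "(m - c) * norm (s k) \<le> \<epsilon>"
      using c by (simp add: field_simps)
    moreover have "m / 2 * norm (s k) \<le> (m - c) * norm (s k)"
      using c by (intro mult_right_mono) auto
    ultimately have "m * norm (s k) \<le> 2 * \<epsilon>"
      by simp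
    with half eps(1) have "m * (norm (x k - z) + norm (s k)) \<le> m * R"
      by (simp add: algebra_simps)
    then have "norm (x k - z) + norm (s k) \<le> R"
      using c by simp
    then have trial: "norm (x k + s k - z) \<le> R"
      using norm_triangle_ineq[of "x k - z" "s k"] by (simp add: algebra_simps)
    have reg: "regularized_step (J (x k)) (F (x k)) (F (x k + s k)) (sP k) (s k) (mu k) ?\<tau> m c L"
      by (rule step) (use lin[OF inv(2) trial] in simp)
    have rho: "\<bar>1 - rho k\<bar> \<le> 1 / 4"
      using trust_ratio_near_one[where F = F and J = J and x = "x k", OF reg]
        cnmtr_runD(6)[OF run, of k] by simp
    then have "rho k \<ge> 3 / 4"
      by linarith
    then have acc: "rho k \<ge> eta_accept"
      by (simp add: eta_accept_def)
    then have next_x: "x (Suc k) = x k + s k"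
      using cnmtr_runD(8)[OF run, of k] by simp
    have "norm (F (x k + s k))
        \<le> (1 - 3 / 4 * (?\<tau> * regularized_step.reduction m c)) * norm (F (x k))"
      by (rule regularized_step.residual_decrease[OF reg])
    also have "\<dots> \<le> 1 * norm (F (x k))"
      using mult_pos_pos[OF tau(1) regularized_step.reduction_pos[OF reg]]
      by (intro mult_right_mono norm_ge_zero) linarith
    finally have "norm (F (x (Suc k))) \<le> \<epsilon>"
      using inv(3) next_x by simp
    with acc trial reg next_x rho show ?thesis
      using cnmtr_runD(7)[OF run, of k] by (simp add: next_time_step_def eta1_def gamma1_def)
  qed
  have inv: "dt k = 2 ^ k / 100 \<and> norm (x k - z) \<le> R \<and> norm (F (x k)) \<le> \<epsilon> \<and>
      (k = 0 \<or> rho (k - 1) \<ge> eta_accept)" for k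
  proof (induction k)
    case 0
    then show ?case
      using cnmtr_runD(1)[OF run] start by simp
  next
    case (Suc k)
    moreover from Suc have "0 < dt k"
      by (metis zero_less_divide_iff zero_less_numeral zero_less_power)
    ultimately show ?case
      using step_preserves[of k] by simp
  qed
  moreover from inv[of k] have "0 < dt k"
    by (metis zero_less_divide_iff zero_less_numeral zero_less_power)
  ultimately show ?thesis
    using step_preserves[of k] by blast
qed

section \<open>Superlinear convergence\<close>

text \<open>
  Superlinear decay of a quantity passes to any comparable one: the constants of comparison
  enter the quotients only through the fixed factor \<open>b / a\<close>.
\<close>

lemma superlinearly_converges_if_residual:
  fixes x :: "nat \<Rightarrow> 'a::real_normed_vector"
  assumes ab: "0 < a" "0 \<le> b"
    and below: "\<And>k. a * norm (x k - l) \<le> f k"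
    and above: "\<And>k. f k \<le> b * norm (x k - l)"
    and pos: "\<And>k. 0 < f k"
    and f: "f \<longlonglongrightarrow> 0"
    and contr: "\<And>k. f (Suc k) \<le> w k * f k" and w: "w \<longlonglongrightarrow> 0"
  shows "superlinearly_converges x l"
proof -
  have "(\<lambda>k. norm (x k - l)) \<longlonglongrightarrow> 0"
  proof (rule tendsto_sandwich[OF _ _ tendsto_const tendsto_divide_zero[OF f, of a]])
    show "\<forall>\<^sub>F k in sequentially. norm (x k - l) \<le> f k / a"
      using below ab by (simp add: field_simps)
  qed simp
  then have "x \<longlonglongrightarrow> l"
    by (simp add: LIM_zero_iff tendsto_norm_zero_iff)
  moreover have "(\<lambda>k. norm (x (Suc k) - l) / norm (x k - l)) \<longlonglongrightarrow> 0"
  proof (rule tendsto_sandwich[OF _ _ tendsto_const])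
    have "norm (x (Suc k) - l) / norm (x k - l) \<le> b / a * w k" for k
    proof -
      have ne: "0 < norm (x k - l)"
        using above[of k] pos[of k] by (cases "x k = l") auto
      have "0 < w k"
        using contr[of k] pos[of k] pos[of "Suc k"] by (meson less_le_trans zero_less_mult_pos2)
      then have "w k * f k \<le> w k * (b * norm (x k - l))"
        using above[of k] by simp
      then have "a * norm (x (Suc k) - l) \<le> w k * (b * norm (x k - l))"
        using below[of "Suc k"] contr[of k] by linarith
      then show ?thesis
        using ne ab by (simp add: field_simps)
    qed
    then show "\<forall>\<^sub>F k in sequentially. norm (x (Suc k) - l) / norm (x k - l) \<le> b / a * w k"
      by simp
    show "(\<lambda>k. b / a * w k) \<longlonglongrightarrow> 0"
      using tendsto_mult_right_zero[OF w] .
  qed simp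
  ultimately show ?thesis
    by (simp add: superlinearly_converges_def)
qed

lemma geometric_decay_tendsto_0:
  fixes f :: "nat \<Rightarrow> real"
  assumes "\<And>k. 0 \<le> f k" "\<And>k. f (Suc k) \<le> q * f k" "0 \<le> q" "q < 1"
  shows "f \<longlonglongrightarrow> 0"
proof (rule tendsto_sandwich[OF _ _ tendsto_const])
  have "f k \<le> q ^ k * f 0" for k
  proof (induction k)
    case (Suc k)
    then show ?case
      using assms(2)[of k] mult_left_mono[OF Suc assms(3)] by simp
  qed simp
  then show "\<forall>\<^sub>F k in sequentially. f k \<le> q ^ k * f 0"
    by simp
  show "(\<lambda>k. q ^ k * f 0) \<longlonglongrightarrow> 0"
    using assms by (intro tendsto_mult_left_zero LIMSEQ_power_zero) auto
qed (use assms in simp)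

text \<open>
  The residuals decay geometrically because \<open>\<tau>\<close> never falls below its initial value
  \<open>1 / 101\<close>; only after \<open>F (x k) \<rightarrow> 0\<close> is known does the sharper factor tend to zero.
\<close>

lemma doubling_steps_converge:
  fixes F :: "real^'n \<Rightarrow> real^'n"
  assumes c: "0 < c" "2 * c < m"
    and step: "\<And>k. regularized_step (J (x k)) (F (x k)) (F (x (Suc k))) (sP k) (s k) (mu k)
      (dt k / (1 + dt k)) m c L"
    and dt: "\<And>k. dt k = 2 ^ k / 100" and mu: "\<And>k. mu k = reg_param c (dt k)"
    and a: "0 < a" "\<And>k. a * norm (x k - z) \<le> norm (F (x k))"
    and b: "0 \<le> b" "\<And>k. norm (F (x k)) \<le> b * norm (x k - z)"
  shows "superlinearly_converges x z"
proof -
  let ?\<tau> = "\<lambda>k. dt k / (1 + dt k)"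
  let ?\<gamma> = "regularized_step.reduction m c"
  have gamma: "0 < ?\<gamma>" "?\<gamma> \<le> 1"
    using regularized_step.reduction_pos[OF step] c
    by (simp_all add: regularized_step.reduction_def[OF step])
  have dt_lim: "filterlim dt at_top sequentially"
  proof -
    have "filterlim (\<lambda>k. 1 / 100 * 2 ^ k :: real) at_top sequentially"
      by (rule filterlim_tendsto_pos_mult_at_top[OF tendsto_const])
        (simp_all add: filterlim_at_infinity_imp_filterlim_at_top
          filterlim_realpow_sequentially_gt1)
    then show ?thesis
      unfolding dt by simp
  qed
  have F_lim: "(\<lambda>k. norm (F (x k))) \<longlonglongrightarrow> 0"
  proof (rule geometric_decay_tendsto_0[where q = "1 - 3 / 4 * (1 / 101 * ?\<gamma>)"])
    show "norm (F (x (Suc k))) \<le> (1 - 3 / 4 * (1 / 101 * ?\<gamma>)) * norm (F (x k))" for k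
    proof -
      have "1 / 101 \<le> ?\<tau> k"
        unfolding dt using one_le_power[of "2 :: real" k]
        by (subst pos_le_divide_eq) (simp_all add: add_pos_pos)
      then have "(1 - 3 / 4 * (?\<tau> k * ?\<gamma>)) * norm (F (x k))
          \<le> (1 - 3 / 4 * (1 / 101 * ?\<gamma>)) * norm (F (x k))"
        using gamma by (intro mult_right_mono diff_left_mono mult_left_mono) auto
      then show ?thesis
        using regularized_step.residual_decrease[OF step, of k] by linarith
    qed
  qed (use gamma in auto)
  let ?w = "\<lambda>k. (1 - ?\<tau> k) + mu k / (m - c) + L * norm (F (x k)) / (m - c)\<^sup>2"
  have dt_inv: "(\<lambda>k. 1 / dt k) \<longlonglongrightarrow> 0"
    using tendsto_divide_0[OF tendsto_const filterlim_at_top_imp_at_infinity[OF dt_lim]] .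
  have "\<forall>\<^sub>F k in sequentially. 1 / c < dt k"
    using dt_lim by (simp add: filterlim_at_top_dense)
  then have "\<forall>\<^sub>F k in sequentially. 1 / dt k = mu k"
    by (rule eventually_mono) (simp add: mu reg_param_def)
  then have mu_lim: "mu \<longlonglongrightarrow> 0"
    using dt_inv by (rule Lim_transform_eventually[rotated])
  have "(\<lambda>k. 1 - ?\<tau> k) \<longlonglongrightarrow> 0"
  proof (rule tendsto_sandwich[OF _ _ tendsto_const dt_inv])
    have pos: "0 < dt k" for k
      by (simp add: dt)
    have "1 - ?\<tau> k = 1 / (1 + dt k)" for k
      using pos[of k] by (simp add: field_simps)
    then have bounds: "0 \<le> 1 - ?\<tau> k" "1 - ?\<tau> k \<le> 1 / dt k" for k
      using pos[of k] by (simp_all add: frac_le)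
    show "\<forall>\<^sub>F k in sequentially. 0 \<le> 1 - ?\<tau> k"
      using bounds by simp
    show "\<forall>\<^sub>F k in sequentially. 1 - ?\<tau> k \<le> 1 / dt k"
      using bounds by simp
  qed
  moreover have "(\<lambda>k. mu k / (m - c)) \<longlonglongrightarrow> 0"
    using tendsto_divide_zero[OF mu_lim] .
  moreover have "(\<lambda>k. L * norm (F (x k)) / (m - c)\<^sup>2) \<longlonglongrightarrow> 0"
    using tendsto_divide_zero[OF tendsto_mult_right_zero[OF F_lim]] .
  ultimately have w: "?w \<longlonglongrightarrow> 0"
    by (intro tendsto_add_zero)
  show ?thesis
  proof (rule superlinearly_converges_if_residual[OF a(1) b(1) a(2) b(2) _ F_lim _ w])
    show "0 < norm (F (x k))" for k
      using regularized_step.f_nonzero[OF step] by simp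
    show "norm (F (x (Suc k))) \<le> ?w k * norm (F (x k))" for k
      by (rule regularized_step.residual_factor[OF step])
  qed
qed

theorem theorem2:
  fixes F :: "real^'n \<Rightarrow> real^'n" and J :: "real^'n \<Rightarrow> real^'n^'n"
    and xs :: "real^'n" and U :: "(real^'n) set" and L \<delta> m c :: real
  assumes "\<And>x. (F has_derivative (\<lambda>h. J x *v h)) (at x)"
    and "continuous_on UNIV J"
    and "F xs = 0"
    and "open U" and "xs \<in> U" and "L > 0"
    and "\<And>x y. x \<in> U \<Longrightarrow> y \<in> U \<Longrightarrow> induced_norm (J x - J y) \<le> L * norm (x - y)"
    and "\<delta> > 0" and "m > 0"
    and "\<And>x y. x \<in> cball xs \<delta> \<Longrightarrow> norm (J x *v y) \<ge> m * norm y"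
    and "c > 0" and "c < 0.5 * m"
  shows "\<exists>r>0. \<forall>x dt mu sP s rho.
           cnmtr_run F J c x dt mu sP s rho \<and> (\<forall>k. mu k \<le> c) \<and> x 0 \<in> cball xs r
           \<longrightarrow> superlinearly_converges x xs"
proof -
  obtain e where e: "e > 0" "cball xs e \<subseteq> U"
    using \<open>open U\<close> \<open>xs \<in> U\<close> open_contains_cball by blast
  \<comment> \<open>\<open>R\<close>: all hypotheses hold in the ball, and \<open>L R \<le> m / 2\<close> makes residual and distance
    comparable there. \<open>\<epsilon>\<close>: confinement and accuracy of the model. \<open>r\<close>: the residual at the
    start is at most \<open>\<epsilon>\<close>.\<close>
  define R where "R = min (min e \<delta>) (m / (2 * L))"
  define \<epsilon> where "\<epsilon> = min (m * R / 4) ((m - c) * (m - 2 * c) / (4 * L))"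
  define M where "M = induced_norm (J xs) + m / 2"
  define r where "r = min R (\<epsilon> / M)"
  have c: "0 < c" "2 * c < m"
    using assms by auto
  have R: "0 < R" "R \<le> e" "R \<le> \<delta>" "R \<le> m / (2 * L)"
    using assms(6,8,9) e(1) by (simp_all add: R_def)
  then have LR: "L * R \<le> m / 2"
    using \<open>L > 0\<close> by (simp add: field_simps)
  have eps: "0 < \<epsilon>" "4 * \<epsilon> \<le> m * R" "4 * L * \<epsilon> \<le> (m - c) * (m - 2 * c)"
  proof -
    show "0 < \<epsilon>"
      using R(1) c \<open>L > 0\<close> \<open>m > 0\<close> by (simp add: \<epsilon>_def)
    show "4 * \<epsilon> \<le> m * R"
      by (simp add: \<epsilon>_def min_def)
    have "\<epsilon> \<le> (m - c) * (m - 2 * c) / (4 * L)"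
      by (simp add: \<epsilon>_def)
    then show "4 * L * \<epsilon> \<le> (m - c) * (m - 2 * c)"
      using \<open>L > 0\<close> by (simp add: pos_le_divide_eq mult_ac)
  qed
  have M: "0 < M"
    using onorm_pos_le[of "\<lambda>v. J xs *v v"] \<open>m > 0\<close> by (simp add: M_def induced_norm_def)
  have r: "0 < r" "r \<le> R" "M * r \<le> \<epsilon>"
    using R eps M by (auto simp: r_def min_def field_simps)
  have ball: "norm (y - xs) \<le> R \<longleftrightarrow> y \<in> cball xs R" for y
    by (simp add: dist_norm norm_minus_commute)
  have lower: "m * norm v \<le> norm (J y *v v)" if "norm (y - xs) \<le> R" for y v
    using assms(10)[of y v] that R(3) by (simp add: ball)
  have lin: "norm (F w - F y - J y *v (w - y)) \<le> L * (norm (w - y))\<^sup>2"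
    if "norm (y - xs) \<le> R" "norm (w - xs) \<le> R" for y w
  proof (rule linearization_error[OF assms(1), where S = "cball xs R"])
    have "cball xs R \<subseteq> U"
      using e(2) R(2) by auto
    then show "induced_norm (J u - J v) \<le> L * norm (u - v)"
      if "u \<in> cball xs R" "v \<in> cball xs R" for u v
      using that assms(7) by blast
  qed (use that ball assms(6) in auto)
  have dist: "m / 2 * norm (y - xs) \<le> norm (F y)" "norm (F y) \<le> M * norm (y - xs)"
    if y: "norm (y - xs) \<le> R" for y
  proof -
    have "norm (F y - J xs *v (y - xs)) \<le> L * (norm (y - xs))\<^sup>2"
      using lin[OF _ y, of xs] R(1) \<open>F xs = 0\<close> by simp
    moreover have "L * norm (y - xs) \<le> m / 2"
      using LR mult_left_mono[OF y, of L] \<open>L > 0\<close> by linarith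
    moreover have "m * norm (y - xs) \<le> norm (J xs *v (y - xs))"
      using lower[of xs] R(1) by simp
    ultimately show "m / 2 * norm (y - xs) \<le> norm (F y)" "norm (F y) \<le> M * norm (y - xs)"
      unfolding M_def by (rule residual_bounds_distance)+
  qed
  have "superlinearly_converges x xs"
    if run: "cnmtr_run F J c x dt mu sP s rho" and mu_le: "\<forall>k. mu k \<le> c"
      and x0: "x 0 \<in> cball xs r" for x dt mu sP s rho
  proof -
    have x0r: "norm (x 0 - xs) \<le> r"
      using x0 by (simp add: dist_norm norm_minus_commute)
    then have x0R: "norm (x 0 - xs) \<le> R"
      using r(2) by simp
    have "norm (F (x 0)) \<le> M * r"
      using dist(2)[OF x0R] mult_left_mono[OF x0r, of M] M by linarith
    then have F0: "norm (F (x 0)) \<le> \<epsilon>"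
      using r(3) by simp
    have inv: "dt k = 2 ^ k / 100 \<and> norm (x k - xs) \<le> R \<and> norm (F (x k)) \<le> \<epsilon> \<and>
        regularized_step (J (x k)) (F (x k)) (F (x (Suc k))) (sP k) (s k) (mu k)
          (dt k / (1 + dt k)) m c L" for k
      using near_zero_run_invariant[OF run _ c _ lower lin dist(1) eps(2,3) x0R F0]
        mu_le \<open>L > 0\<close> by simp
    show ?thesis
    proof (rule doubling_steps_converge[OF c, where F = F and a = "m / 2" and b = M])
      show "regularized_step (J (x k)) (F (x k)) (F (x (Suc k))) (sP k) (s k) (mu k)
          (dt k / (1 + dt k)) m c L" "dt k = 2 ^ k / 100" for k
        using inv by blast+
      show "mu k = reg_param c (dt k)" for k
        using cnmtr_runD(3)[OF run] .
      show "0 < m / 2" "0 \<le> M"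
        using \<open>m > 0\<close> M by simp_all
      show "m / 2 * norm (x k - xs) \<le> norm (F (x k))" "norm (F (x k)) \<le> M * norm (x k - xs)" for k
        using inv dist by blast+
    qed
  qed
  then show ?thesis
    using r(1) by blast
qed

end
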